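(* Let $a$ and $d$ be integers with $a\ge 3$, $a$ even, $d>0$ and $\gcd(a,d)=1$. Then $S_p(a,a+d,a+2d)$ is $p$-symmetric when $p=\frac a2-1$.
   Context: For a finite set $A=\{a_1,\dots,a_k\}$ ($k\ge 2$) of positive integers with $\gcd(a_1,\dots,a_k)=1$, let $N(n;A)$ be the number of tuples $(x_1,\dots,x_k)$ of non-negative integers with $a_1x_1+\cdots+a_kx_k=n$. For an integer $p\ge 0$ put $S_p(A)=\{n\in\mathbb N_0 : N(n;A)>p\}$ and $G_p(A)=\mathbb N_0\setminus S_p(A)$. Let $g_p(A)=\max G_p(A)$ and let $\ell_0(p)=\min S_p(A)$. $S_p(A)$ is called $p$-symmetric if for all $x\in\mathbb Z\setminus S_p(A)$ one has $\ell_0(p)+g_p(A)-x\in S_p(A)$. Here $S_p(a,a+d,a+2d)$ means $S_p(\{a,a+d,a+2d\})$. *)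

theory Defs
  imports "HOL-Library.FuncSet"
begin

(* The tuples (x_1,...,x_k) of non-negative integers are extensional functions on the set A,
   so that each tuple is counted once; the set of solutions is finite when A is finite and
   consists of positive integers. *)
definition num_repr :: "int \<Rightarrow> int set \<Rightarrow> nat" where
  "num_repr n A = card {x \<in> A \<rightarrow>\<^sub>E (UNIV :: nat set). (\<Sum>a\<in>A. a * int (x a)) = n}"

definition S_set :: "nat \<Rightarrow> int set \<Rightarrow> int set" where
  "S_set p A = {n. 0 \<le> n \<and> num_repr n A > p}"

definition G_set :: "nat \<Rightarrow> int set \<Rightarrow> int set" where
  "G_set p A = {n. 0 \<le> n} - S_set p A"

(* Meaningful when the gap set is finite and nonempty: finiteness holds for finite sets A of at
   least two positive integers with gcd 1; nonemptiness fails only for p = 0 and 1 in A. *)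
definition p_Frobenius :: "nat \<Rightarrow> int set \<Rightarrow> int" where
  "p_Frobenius p A = Max (G_set p A)"

(* Min is reserved for finite sets, and S_set p A is infinite in the cases of interest. *)
definition least_elem :: "nat \<Rightarrow> int set \<Rightarrow> int" where
  "least_elem p A = (LEAST n. n \<in> S_set p A)"

definition p_symmetric :: "nat \<Rightarrow> int set \<Rightarrow> bool" where
  "p_symmetric p A \<longleftrightarrow>
     (\<forall>x. x \<notin> S_set p A \<longrightarrow> least_elem p A + p_Frobenius p A - x \<in> S_set p A)"

end

theory Submission
  imports Defs "HOL-Number_Theory.Cong"
begin

text \<open>
  Write \<open>a = 2 * m\<close>. Every integer is \<open>n = (a - 2) * (a + d) + a * q + d * r\<close> with \<open>0 \<le> r < a\<close>,
  and the point is that \<open>n\<close> has at least \<open>m\<close> representations iff \<open>q \<ge> r mod 2\<close>. In a solution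
  \<open>a * x + (a + d) * y + (a + 2 * d) * z = n\<close> the parity of \<open>y\<close> is that of \<open>r\<close>; with \<open>w = y div 2\<close>
  the pair \<open>(x + w, z + w)\<close> solves a linear equation with coefficients \<open>m\<close> and \<open>m + d\<close>, so it lies
  on a progression with step \<open>(- (m + d), m)\<close>, and at most two of its members matter. The
  condition \<open>q \<ge> r mod 2\<close> is exchanged with its negation by \<open>(q, r) \<mapsto> (- q, a - 1 - r)\<close>, which is
  the reflection of the definition of symmetry.
\<close>

definition solutions :: "int \<Rightarrow> int \<Rightarrow> int \<Rightarrow> int \<Rightarrow> (int \<times> int \<times> int) set" where
  "solutions a b c n =
     {(x, y, z). 0 \<le> x \<and> 0 \<le> y \<and> 0 \<le> z \<and> a * x + b * y + c * z = n}"

lemma num_repr_eq_card_solutions: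
  assumes "distinct [a, b, c]"
  shows "num_repr n {a, b, c} = card (solutions a b c n)"
proof -
  let ?F = "{x \<in> {a, b, c} \<rightarrow>\<^sub>E (UNIV :: nat set). (\<Sum>i\<in>{a, b, c}. i * int (x i)) = n}"
  let ?h = "\<lambda>f :: int \<Rightarrow> nat. (int (f a), int (f b), int (f c))"
  let ?g = "\<lambda>(x, y, z). \<lambda>i. if i = a then nat x else if i = b then nat y
              else if i = c then nat z else undefined"
  have "bij_betw ?h ?F (solutions a b c n)"
    by (rule bij_betw_byWitness[where f' = ?g])
      (use assms in \<open>auto simp: solutions_def PiE_def extensional_def fun_eq_iff add.assoc\<close>)
  then show ?thesis
    unfolding num_repr_def by (rule bij_betw_same_card)
qed

lemma finite_solutions:
  assumes "0 < a" "0 < b" "0 < c"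
  shows "finite (solutions a b c n)"
proof (rule finite_subset)
  show "solutions a b c n \<subseteq> {0..n} \<times> {0..n} \<times> {0..n}"
  proof
    fix s assume "s \<in> solutions a b c n"
    then obtain x y z where s: "s = (x, y, z)" and nn: "0 \<le> x" "0 \<le> y" "0 \<le> z"
      and eq: "a * x + b * y + c * z = n"
      by (auto simp: solutions_def)
    have "x \<le> a * x" "y \<le> b * y" "z \<le> c * z"
      using assms nn by (simp_all add: mult_le_cancel_right1)
    then show "s \<in> {0..n} \<times> {0..n} \<times> {0..n}"
      using s nn eq by auto
  qed
qed simp

lemma coprime_linear_solutions:
  fixes m c u v x z :: int
  assumes "coprime m c" "m \<noteq> 0" "m * x + c * z = m * u + c * v"
  obtains k where "x = u - c * k" "z = v + m * k"
proof -
  have eq: "c * (z - v) = m * (u - x)"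
    using assms(3) by (simp add: algebra_simps)
  then have "m dvd c * (z - v)" by simp
  then have "m dvd z - v"
    using assms(1) by (simp add: coprime_dvd_mult_right_iff)
  then obtain k where k: "z - v = m * k" ..
  with eq have "m * (u - x) = m * (c * k)" by (simp only: mult.left_commute)
  then have "u - x = c * k" using assms(2) by simp
  with k show ?thesis by (intro that[of k]) auto
qed

context
  fixes m d :: int
  assumes m: "0 < m" and d: "0 < d" and coprime: "coprime (2 * m) d"
begin

lemma odd_d: "odd d"
  using coprime by (simp add: coprime_left_2_iff_odd)

text \<open>Two families, indexed by \<open>w = y div 2\<close>, supply \<rho> and
  \<open>m - \<rho>\<close> solutions. The first has \<open>z + w = \<rho> - 1\<close>; the second
  has \<open>z + w = m - 1 + \<rho>\<close>, and stopping it at \<open>w = m - 1 - \<rho>\<close>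
  keeps \<open>x\<close> nonnegative because \<open>0 \<le> e\<close>.\<close>

lemma card_solutions_ge:
  fixes e \<epsilon> \<rho> :: int
  assumes "0 \<le> \<epsilon>" "0 \<le> \<rho>" "\<rho> < m" "0 \<le> e"
  shows "nat m \<le> card (solutions (2 * m) (2 * m + d) (2 * m + 2 * d)
    ((2 * m - 2) * (2 * m + d) + 2 * m * (e + \<epsilon>) + d * (2 * \<rho> + \<epsilon>)))"
    (is "_ \<le> card ?S")
proof -
  define h where "h = (\<lambda>i. if i < \<rho>
    then (e + m - 1 - \<rho> + (m + d) - i, 2 * i + \<epsilon>, \<rho> - 1 - i)
    else (e + m - 1 - \<rho> - (i - \<rho>), 2 * (i - \<rho>) + \<epsilon>, m - 1 + \<rho> - (i - \<rho>)))"
  \<comment> \<open>The branches cannot collide: \<open>z < \<rho>\<close> in the first,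
    \<open>z \<ge> 2 * \<rho>\<close> in the second.\<close>
  have "inj_on h {0..<m}"
    using m by (auto simp: inj_on_def h_def split: if_splits)
  moreover have "h ` {0..<m} \<subseteq> ?S"
    using assms m d by (auto simp: h_def solutions_def algebra_simps)
  moreover have "finite ?S"
    using m d by (intro finite_solutions) auto
  ultimately have "card {0..<m} \<le> card ?S"
    by (rule card_inj_on_le)
  then show ?thesis by simp
qed

text \<open>The same two families are now shown to be exhaustive. One has at most \<rho> members
  since \<open>z \<ge> 0\<close>; in the other \<open>x \<ge> 0\<close> and \<open>e < 0\<close>
  force \<open>w \<le> m - 2 - \<rho>\<close>, so the total is at most \<open>m - 1\<close>.\<close>

lemma card_solutions_less:
  fixes e \<epsilon> \<rho> :: int
  assumes "\<epsilon> \<in> {0, 1}" "0 \<le> \<rho>" "\<rho> < m" "e < 0"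
  shows "card (solutions (2 * m) (2 * m + d) (2 * m + 2 * d)
    ((2 * m - 2) * (2 * m + d) + 2 * m * (e + \<epsilon>) + d * (2 * \<rho> + \<epsilon>))) < nat m"
    (is "card ?S < _")
proof -
  define u v where "u = e + m - 1 - \<rho>" and "v = m - 1 + \<rho>"
  have cases: "\<exists>w \<ge> 0. y = 2 * w + \<epsilon> \<and>
      (x + w = u \<and> z + w = v \<or> x + w = u + (m + d) \<and> z + w = v - m)"
    if "(x, y, z) \<in> ?S" for x y z
  proof -
    from that have nn: "0 \<le> x" "0 \<le> y" "0 \<le> z"
      and eq: "2 * m * x + (2 * m + d) * y + (2 * m + 2 * d) * z =
        (2 * m - 2) * (2 * m + d) + 2 * m * (e + \<epsilon>) + d * (2 * \<rho> + \<epsilon>)"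
      by (auto simp: solutions_def)
    have "d * (y - \<epsilon>) = 2 * ((m - 1) * (2 * m + d) + m * (e + \<epsilon>) + d * \<rho>
        - m * x - m * y - (m + d) * z)"
      using eq by (simp add: algebra_simps)
    then have "even (d * (y - \<epsilon>))" by simp
    then have "even (y - \<epsilon>)" using odd_d by simp
    then obtain w where "y - \<epsilon> = 2 * w" ..
    then have y: "y = 2 * w + \<epsilon>" by simp
    have w: "0 \<le> w" using y nn assms(1) by auto
    \<comment> \<open>As \<open>2 * m + d = m + (m + d)\<close>, the \<open>2 * w\<close> part of
      \<open>y\<close> can be split evenly between \<open>x\<close> and \<open>z\<close>;
      \<open>(u, v)\<close> is a particular solution of the resulting equation.\<close>
    have "2 * (m * (x + w) + (m + d) * (z + w)) = 2 * (m * u + (m + d) * v)"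
      using eq unfolding y u_def v_def by (simp add: algebra_simps)
    then have "m * (x + w) + (m + d) * (z + w) = m * u + (m + d) * v" by simp
    moreover have "coprime m (m + d)"
      using coprime by (metis coprime_iff_gcd_eq_1 coprime_mult_left_iff gcd_add2)
    ultimately obtain k where k: "x + w = u - (m + d) * k" "z + w = v + m * k"
      using m by (elim coprime_linear_solutions[rotated 2]) auto
    \<comment> \<open>For \<open>k \<ge> 1\<close>, \<open>x + w\<close> would be at most
      \<open>e - 1 - \<rho> - d\<close>; for \<open>k \<le> - 2\<close>, \<open>z + w\<close> would
      be at most \<open>\<rho> - 1 - m\<close>. Both are negative.\<close>
    have "k < 1"
    proof (rule ccontr)
      assume "\<not> k < 1"
      then have "(m + d) * 1 \<le> (m + d) * k"
        using m d by (intro mult_left_mono) auto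
      then show False using k nn w assms(2,4) d by (simp add: u_def ring_distribs)
    qed
    moreover have "- 2 < k"
    proof (rule ccontr)
      assume "\<not> - 2 < k"
      then have "m * k \<le> m * - 2"
        using m by (intro mult_left_mono) auto
      then show False using k nn w assms(3) unfolding v_def by linarith
    qed
    ultimately have "k = 0 \<or> k = - 1" by auto
    with k y w show ?thesis by auto
  qed
  \<comment> \<open>Packs both families into one interval: the family through \<open>(u, v)\<close>
    is shifted by \<rho>, past the values below \<rho> taken by the other. The test separates them
    because the other has \<open>z + w = v - m\<close>.\<close>
  define f where "f = (\<lambda>(x :: int, y :: int, z).
    if y div 2 + z = v then \<rho> + y div 2 else y div 2)"
  have half: "(2 * w + \<epsilon>) div 2 = w" for w
    using assms(1) by auto
  have f: "\<exists>w \<ge> 0. s = (u - w, 2 * w + \<epsilon>, v - w) \<and> w \<le> u \<and> f s = \<rho> + w \<or>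
      s = (u + (m + d) - w, 2 * w + \<epsilon>, v - m - w) \<and> w < \<rho> \<and> f s = w"
    if s: "s \<in> ?S" for s
  proof -
    obtain x y z where xyz: "s = (x, y, z)" by (cases s)
    from s xyz have nn: "0 \<le> x" "0 \<le> z" by (auto simp: solutions_def)
    from s xyz cases obtain w where w: "0 \<le> w" "y = 2 * w + \<epsilon>"
      "x + w = u \<and> z + w = v \<or> x + w = u + (m + d) \<and> z + w = v - m" by blast
    then show ?thesis
      using nn m by (intro exI[of _ w]) (auto simp: xyz f_def half v_def)
  qed
  have "inj_on f ?S"
  proof (rule inj_onI)
    fix s t assume "s \<in> ?S" "t \<in> ?S" "f s = f t"
    with f[of s] f[of t] show "s = t" by auto
  qed
  moreover have "f ` ?S \<subseteq> {0..<m - 1}"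
  proof
    fix i assume "i \<in> f ` ?S"
    then obtain s where "s \<in> ?S" "i = f s" by auto
    with f[of s] show "i \<in> {0..<m - 1}"
      using assms by (auto simp: u_def)
  qed
  ultimately have "card ?S \<le> card {0..<m - 1}"
    by (rule card_inj_on_le) simp
  then show ?thesis using m by simp
qed

lemma mem_S_set_iff:
  fixes q r :: int
  assumes "0 \<le> r" "r < 2 * m"
  shows "(2 * m - 2) * (2 * m + d) + 2 * m * q + d * r
      \<in> S_set (nat (m - 1)) {2 * m, 2 * m + d, 2 * m + 2 * d} \<longleftrightarrow> r mod 2 \<le> q"
    (is "?n \<in> S_set _ ?A \<longleftrightarrow> _")
proof -
  define e where "e = q - r mod 2"
  have n: "?n = (2 * m - 2) * (2 * m + d) + 2 * m * (e + r mod 2)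
      + d * (2 * (r div 2) + r mod 2)"
    by (simp add: e_def)
  have num: "num_repr ?n ?A = card (solutions (2 * m) (2 * m + d) (2 * m + 2 * d) ?n)"
    using d by (intro num_repr_eq_card_solutions) auto
  have \<rho>: "0 \<le> r div 2" "r div 2 < m" using assms by auto
  show ?thesis
  proof (cases "r mod 2 \<le> q")
    case True
    then have "0 \<le> q" using pos_mod_sign[of 2 r] by linarith
    then have "0 \<le> ?n"
      using m d assms by (intro add_nonneg_nonneg mult_nonneg_nonneg) auto
    moreover have "nat m \<le> num_repr ?n ?A"
      unfolding num unfolding n by (rule card_solutions_ge) (use True \<rho> in \<open>auto simp: e_def\<close>)
    ultimately show ?thesis using True m by (auto simp: S_set_def)
  next
    case False
    have "num_repr ?n ?A < nat m"
      unfolding num unfolding n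
      by (rule card_solutions_less) (use False \<rho> in \<open>auto simp: e_def\<close>)
    then show ?thesis using False m by (auto simp: S_set_def)
  qed
qed

text \<open>Since \<open>d\<close> is invertible modulo \<open>2 * m\<close>, the residue of
  \<open>n\<close> minus the offset determines \<open>r\<close>, and \<open>q\<close> is the
  remaining quotient.\<close>

lemma exists_coordinates:
  fixes n :: int
  obtains q r where "n = (2 * m - 2) * (2 * m + d) + 2 * m * q + d * r" "0 \<le> r" "r < 2 * m"
proof -
  let ?k = "n - (2 * m - 2) * (2 * m + d)"
  obtain t where "[d * t = 1] (mod (2 * m))"
    using coprime cong_solve_coprime_int[of d "2 * m"] by (auto simp: coprime_commute)
  then have "[d * t * ?k = 1 * ?k] (mod (2 * m))"
    by (rule cong_mult) simp
  moreover have "[d * ((t * ?k) mod (2 * m)) = d * (t * ?k)] (mod (2 * m))"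
    by (intro cong_mult) (auto simp: cong_def)
  ultimately have "[?k = d * ((t * ?k) mod (2 * m))] (mod (2 * m))"
    by (simp add: cong_def mult.assoc)
  then obtain q where "?k - d * ((t * ?k) mod (2 * m)) = 2 * m * q"
    unfolding cong_iff_dvd_diff by (rule dvdE)
  then show ?thesis
    using m by (intro that[of q "(t * ?k) mod (2 * m)"]) auto
qed

lemma least_elem_eq:
  "least_elem (nat (m - 1)) {2 * m, 2 * m + d, 2 * m + 2 * d} = (2 * m - 2) * (2 * m + d)"
  unfolding least_elem_def
proof (rule Least_equality)
  show "(2 * m - 2) * (2 * m + d) \<in> S_set (nat (m - 1)) {2 * m, 2 * m + d, 2 * m + 2 * d}"
    using mem_S_set_iff[of 0 0] m by simp
next
  fix n assume n: "n \<in> S_set (nat (m - 1)) {2 * m, 2 * m + d, 2 * m + 2 * d}"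
  obtain q r where qr: "n = (2 * m - 2) * (2 * m + d) + 2 * m * q + d * r" "0 \<le> r" "r < 2 * m"
    by (rule exists_coordinates)
  with n have "r mod 2 \<le> q" using mem_S_set_iff by blast
  then have "0 \<le> q" using pos_mod_sign[of 2 r] by linarith
  then have "0 \<le> 2 * m * q" "0 \<le> d * r" using m d qr by simp_all
  then show "(2 * m - 2) * (2 * m + d) \<le> n" using qr by linarith
qed

text \<open>Nonmembership forces \<open>q \<le> 0\<close>, and the extreme case
  \<open>q = 0\<close>, \<open>r = 2 * m - 1\<close> is a nonmember because this \<open>r\<close> is
  odd.\<close>

lemma p_Frobenius_eq:
  "p_Frobenius (nat (m - 1)) {2 * m, 2 * m + d, 2 * m + 2 * d}
     = (2 * m - 2) * (2 * m + d) + d * (2 * m - 1)" (is "p_Frobenius ?p ?A = ?g")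
proof -
  have bound: "n \<le> ?g" if n: "n \<in> G_set ?p ?A" for n
  proof -
    obtain q r where qr: "n = (2 * m - 2) * (2 * m + d) + 2 * m * q + d * r" "0 \<le> r" "r < 2 * m"
      by (rule exists_coordinates)
    with n have "\<not> r mod 2 \<le> q" using mem_S_set_iff by (auto simp: G_set_def)
    then have "q \<le> 0" using pos_mod_bound[of 2 r] by linarith
    then have "2 * m * q \<le> 0" using m by (simp add: mult_le_0_iff)
    moreover have "d * r \<le> d * (2 * m - 1)" using qr d by (intro mult_left_mono) auto
    ultimately show ?thesis using qr by linarith
  qed
  have "0 \<le> ?g" using m d by (intro add_nonneg_nonneg mult_nonneg_nonneg) auto
  moreover have "?g \<notin> S_set ?p ?A"
    using mem_S_set_iff[of "2 * m - 1" 0] m by (simp add: mod_diff_left_eq[symmetric])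
  ultimately have "?g \<in> G_set ?p ?A" by (simp add: G_set_def)
  moreover have "finite (G_set ?p ?A)"
    by (rule finite_subset[of _ "{0..?g}"]) (use bound in \<open>auto simp: G_set_def\<close>)
  ultimately show ?thesis
    unfolding p_Frobenius_def using bound by (intro Max_eqI) auto
qed

lemma p_symmetric_double:
  "p_symmetric (nat (m - 1)) {2 * m, 2 * m + d, 2 * m + 2 * d}"
  unfolding p_symmetric_def
proof (intro allI impI)
  let ?S = "S_set (nat (m - 1)) {2 * m, 2 * m + d, 2 * m + 2 * d}"
  fix x assume x: "x \<notin> ?S"
  obtain q r where qr: "x = (2 * m - 2) * (2 * m + d) + 2 * m * q + d * r" "0 \<le> r" "r < 2 * m"
    by (rule exists_coordinates)
  with x have "\<not> r mod 2 \<le> q" using mem_S_set_iff by blast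
  \<comment> \<open>\<open>r\<close> and \<open>2 * m - 1 - r\<close> have opposite parities, so
    over the integers \<open>q < r mod 2\<close> turns into
    \<open>- q \<ge> 1 - r mod 2\<close>.\<close>
  then have "(2 * m - 1 - r) mod 2 \<le> - q" by presburger
  then have "(2 * m - 2) * (2 * m + d) + 2 * m * (- q) + d * (2 * m - 1 - r) \<in> ?S"
    using mem_S_set_iff[of "2 * m - 1 - r" "- q"] qr by auto
  then show "least_elem (nat (m - 1)) {2 * m, 2 * m + d, 2 * m + 2 * d}
      + p_Frobenius (nat (m - 1)) {2 * m, 2 * m + d, 2 * m + 2 * d} - x \<in> ?S"
    unfolding least_elem_eq p_Frobenius_eq qr(1) by (simp add: algebra_simps)
qed

end

theorem theorem2:
  fixes a d :: int and p :: nat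
  assumes "a \<ge> 3" and "even a" and "d > 0" and "gcd a d = 1"
    and "int p = a div 2 - 1"
  shows "p_symmetric p {a, a + d, a + 2 * d}"
proof -
  obtain m where a: "a = 2 * m" using assms(2) by (rule evenE)
  have "p = nat (m - 1)" using assms(5) by (simp add: a)
  moreover have "coprime (2 * m) d" using assms(4) by (simp add: a coprime_iff_gcd_eq_1)
  ultimately show ?thesis
    using p_symmetric_double[of m d] assms by (simp add: a)
qed

end
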